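(* Assume that $f:\mathbb{R}^n\to\mathbb{R}$ is Lipschitz with $\mathrm{LIP}[f]>0$, and that $g:\mathbb{R}^n\to(0,\mathrm{LIP}[f]]$ is a strictly positive lower semicontinuous function which is an upper gradient for $f$, satisfying $g|_{\mathbb{R}^n\setminus B(0,R)}\equiv\mathrm{LIP}[f]$ for some $R>0$. Let $(g_i)_{i=1}^\infty$ be an increasing sequence of continuous functions on $\mathbb{R}^n$ with $g_i\to g$ pointwise and $g_i|_{\mathbb{R}^n\setminus B(0,R)}\equiv\mathrm{LIP}[f]$ for all $i\in\mathbb{N}$. Then there exists a sequence of $\mathrm{LIP}[f]$-Lipschitz functions $f_i:\mathbb{R}^n\to\mathbb{R}$ that converges weak-$*$ to $f$ and for which $$\mathrm{Lip}_a[f_i](x)\le g_i(x)\qquad\text{for all }i\in\mathbb{N}\text{ and all }x\in\mathbb{R}^n.$$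
   Context: $\mathbb{R}^n$ carries the Euclidean distance and $B(x,r)$ is the open ball of radius $r$ centered at $x$. $\mathrm{LIP}[h]$ is the smallest Lipschitz constant of $h$, and $\mathrm{Lip}_a[h](x)=\lim_{r\to0}\mathrm{LIP}[h|_{B(x,r)}]$ is the asymptotic Lipschitz constant of $h$ at $x$. A function is $L$-Lipschitz if its Lipschitz constant is at most $L$. A Borel function $g:\mathbb{R}^n\to[0,\infty]$ is an upper gradient of $f:\mathbb{R}^n\to\mathbb{R}$ if $|f(\gamma(a))-f(\gamma(b))|\le\int_\gamma g\,ds$ for all rectifiable curves $\gamma:[a,b]\to\mathbb{R}^n$, where $\int_\gamma g\,ds$ is the line integral with respect to arc length. A sequence of Lipschitz functions $f_i:\mathbb{R}^n\to\mathbb{R}$ converges weak-$*$ to a Lipschitz function $f$ if $f_i\to f$ pointwise and $\sup_i\mathrm{LIP}[f_i]<\infty$. "Increasing" means $g_i\le g_{i+1}$ for all $i$.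
   Formalization: The functions g_i are additionally assumed nonnegative; without this the claim fails, since Lip_a[f_i] ≥ 0 always, while an early g_i could take negative values inside B(0,R). *)

theory Defs
  imports "HOL-Analysis.Analysis"
begin

text \<open>The value is \<open>\<infinity>\<close> when the function is not Lipschitz on the set.\<close>

definition LIP :: "'a::metric_space set \<Rightarrow> ('a \<Rightarrow> 'b::metric_space) \<Rightarrow> ennreal" where
  "LIP S h = Inf {ennreal L | L. L-lipschitz_on S h}"

lemma lipschitz_on_iff_LIP_le:
  assumes "0 \<le> L"
  shows "L-lipschitz_on S h \<longleftrightarrow> LIP S h \<le> ennreal L"
proof
  assume "L-lipschitz_on S h"
  then show "LIP S h \<le> ennreal L"
    unfolding LIP_def by (intro Inf_lower) auto
next
  assume le: "LIP S h \<le> ennreal L"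
  show "L-lipschitz_on S h"
  proof (rule lipschitz_onI)
    fix x y assume xy: "x \<in> S" "y \<in> S"
    show "dist (h x) (h y) \<le> L * dist x y"
    proof (rule field_le_epsilon)
      fix e :: real assume "0 < e"
      define d where "d = e / (1 + dist x y)"
      have pos: "0 < 1 + dist x y" by (simp add: add_pos_nonneg)
      with \<open>0 < e\<close> have d: "0 < d" by (simp add: d_def)
      have "LIP S h < ennreal (L + d)"
        using le by (rule le_less_trans) (use d assms in \<open>simp add: ennreal_less_iff\<close>)
      then obtain M where M: "M-lipschitz_on S h" "ennreal M < ennreal (L + d)"
        unfolding LIP_def Inf_less_iff by auto
      have "0 \<le> M" using M(1) by (rule lipschitz_on_nonneg)
      with M(2) have "M < L + d" by (simp add: ennreal_less_iff)
      have "dist (h x) (h y) \<le> M * dist x y"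
        using M(1) xy by (rule lipschitz_onD)
      also have "\<dots> \<le> (L + d) * dist x y"
        using \<open>M < L + d\<close> by (intro mult_right_mono) auto
      also have "\<dots> = L * dist x y + d * dist x y" by (simp add: algebra_simps)
      also have "d * dist x y \<le> d * (1 + dist x y)"
        using d by (intro mult_left_mono) auto
      also have "d * (1 + dist x y) = e" using pos by (simp add: d_def)
      finally show "dist (h x) (h y) \<le> L * dist x y + e" by simp
    qed
  qed (rule assms)
qed

lemma LIP_mono: "S \<subseteq> T \<Longrightarrow> LIP S h \<le> LIP T h"
  unfolding LIP_def by (intro Inf_superset_mono) (auto intro: lipschitz_on_subset)

definition Lip_a :: "('a::metric_space \<Rightarrow> 'b::metric_space) \<Rightarrow> 'a \<Rightarrow> ennreal" where
  "Lip_a h x = Lim (at_right 0) (\<lambda>r. LIP (ball x r) h)"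

text \<open>By monotonicity in \<open>r\<close> the limit always exists.\<close>

lemma tendsto_Lip_a: "((\<lambda>r. LIP (ball x r) h) \<longlongrightarrow> Lip_a h x) (at_right 0)"
proof -
  let ?l = "INF r\<in>{0<..}. LIP (ball x r) h"
  have "((\<lambda>r. LIP (ball x r) h) \<longlongrightarrow> ?l) (at_right 0)"
  proof (rule order_tendstoI)
    fix c assume c: "c < ?l"
    have "c < LIP (ball x r) h" if "0 < r" for r
      using c that by (meson INF_lower greaterThan_iff less_le_trans)
    then show "\<forall>\<^sub>F r in at_right 0. c < LIP (ball x r) h"
      by (auto simp: eventually_at_right_field intro!: exI[of _ 1])
  next
    fix c assume "?l < c"
    then obtain r where r: "0 < r" "LIP (ball x r) h < c"
      by (auto simp: Inf_less_iff)
    have "LIP (ball x s) h < c" if "s < r" for s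
      using LIP_mono[of "ball x s" "ball x r" h] that r(2)
      by (metis le_less_trans less_imp_le subset_ball)
    with r(1) show "\<forall>\<^sub>F r in at_right 0. LIP (ball x r) h < c"
      by (auto simp: eventually_at_right_field)
  qed
  then show ?thesis
    unfolding Lip_a_def by (simp add: tendsto_Lim)
qed

definition lower_semicontinuous :: "('a::topological_space \<Rightarrow> real) \<Rightarrow> bool" where
  "lower_semicontinuous g \<longleftrightarrow> (\<forall>c. open {x. c < g x})"

definition curve_length :: "(real \<Rightarrow> 'a::metric_space) \<Rightarrow> real \<Rightarrow> real \<Rightarrow> ennreal" where
  "curve_length \<gamma> a b =
     (SUP (n, t) \<in> {(n::nat, t::nat \<Rightarrow> real). t 0 = a \<and> t n = b \<and> (\<forall>i<n. t i \<le> t (Suc i))}.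
        \<Sum>i<n. ennreal (dist (\<gamma> (t i)) (\<gamma> (t (Suc i)))))"

definition rectifiable_curve :: "(real \<Rightarrow> 'a::metric_space) \<Rightarrow> real \<Rightarrow> real \<Rightarrow> bool" where
  "rectifiable_curve \<gamma> a b \<longleftrightarrow> a \<le> b \<and> continuous_on {a..b} \<gamma> \<and> curve_length \<gamma> a b < \<infinity>"

text \<open>For a rectifiable curve the length function \<open>t \<mapsto> curve_length \<gamma> a t\<close> maps
  \<open>{a..b}\<close> onto \<open>[0, curve_length \<gamma> a b]\<close>, and \<open>\<gamma>\<close> is constant on its level sets, so the
  choice of \<open>t\<close> does not matter.\<close>

definition arclength_param :: "(real \<Rightarrow> 'a::metric_space) \<Rightarrow> real \<Rightarrow> real \<Rightarrow> real \<Rightarrow> 'a" where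
  "arclength_param \<gamma> a b s = \<gamma> (SOME t. t \<in> {a..b} \<and> curve_length \<gamma> a t = ennreal s)"

definition line_integral ::
    "(real \<Rightarrow> 'a::metric_space) \<Rightarrow> real \<Rightarrow> real \<Rightarrow> ('a \<Rightarrow> ennreal) \<Rightarrow> ennreal" where
  "line_integral \<gamma> a b g =
     (\<integral>\<^sup>+ s \<in> {0..enn2real (curve_length \<gamma> a b)}. g (arclength_param \<gamma> a b s) \<partial>lborel)"

definition upper_gradient :: "('a::metric_space \<Rightarrow> ennreal) \<Rightarrow> ('a \<Rightarrow> real) \<Rightarrow> bool" where
  "upper_gradient g f \<longleftrightarrow> g \<in> borel_measurable borel \<and>
     (\<forall>\<gamma> a b. rectifiable_curve \<gamma> a b \<longrightarrow>
        ennreal \<bar>f (\<gamma> a) - f (\<gamma> b)\<bar> \<le> line_integral \<gamma> a b g)"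

definition weak_star_converges ::
    "(nat \<Rightarrow> 'a::metric_space \<Rightarrow> real) \<Rightarrow> ('a \<Rightarrow> real) \<Rightarrow> bool" where
  "weak_star_converges F f \<longleftrightarrow>
     (\<forall>i. \<exists>L. L-lipschitz_on UNIV (F i)) \<and> (\<exists>L. L-lipschitz_on UNIV f) \<and>
     (\<forall>x. (\<lambda>i. F i x) \<longlonglongrightarrow> f x) \<and> (SUP i. LIP UNIV (F i)) < \<infinity>"

end

theory Submission
  imports Defs "HOL-Complex_Analysis.Great_Picard"
begin

text \<open>
  Let \<open>f\<^sub>i(x)\<close> be the infimum of \<open>f(\<gamma>(T)) + \<integral>\<^bsub>[0,T]\<^esub> g\<^sub>i(\<gamma>(s)) ds\<close> over all \<open>T \<ge> 0\<close> and all
  1-Lipschitz curves \<open>\<gamma>\<close> on \<open>[0,T]\<close> starting at \<open>x\<close>. Prepending a segment to a curve gives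
  \<open>f\<^sub>i(u) - f\<^sub>i(v) \<le> c |u - v|\<close> whenever \<open>g\<^sub>i \<le> c\<close> on \<open>[u,v]\<close>, which yields both Lipschitz bounds.
  The sequence \<open>f\<^sub>i(x)\<close> increases and is at most \<open>f(x)\<close>. If its limit were smaller, there would be
  curves of cost below some \<open>e < f(x)\<close> for every \<open>i\<close>. They may be stopped at their last visit to
  the closed ball, since outside of it \<open>g\<^sub>i = LIP[f]\<close>; as \<open>g\<^sub>i\<close> is eventually bounded away from \<open>0\<close>,
  the durations \<open>T\<close> are then bounded. Rescaled to \<open>[0,1]\<close>, these curves subconverge by Arzela-Ascoli
  to a \<open>C\<close>-Lipschitz curve \<open>\<eta>\<close> with \<open>f(\<eta>(1)) + C \<integral>\<^bsub>[0,1]\<^esub> g\<^sub>j(\<eta>(s)) ds \<le> e\<close> for all \<open>j\<close>.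
  As arc length grows at rate at most \<open>C\<close>, the line integral of \<open>g\<^sub>j\<close> along \<open>\<eta>\<close> is at most
  \<open>C \<integral>\<^bsub>[0,1]\<^esub> g\<^sub>j(\<eta>(s)) ds\<close>, and letting \<open>j \<rightarrow> \<infinity>\<close> contradicts that \<open>g\<close> is an upper gradient of \<open>f\<close>.
\<close>

section \<open>Lipschitz constants\<close>

lemma LIP_attained:
  assumes "M-lipschitz_on S h"
  obtains L where "L-lipschitz_on S h" "LIP S h = ennreal L"
proof
  have "LIP S h \<le> ennreal M"
    using assms lipschitz_on_nonneg by (metis lipschitz_on_iff_LIP_le)
  then show "LIP S h = ennreal (enn2real (LIP S h))"
    by (simp add: le_less_trans)
  then show "(enn2real (LIP S h))-lipschitz_on S h"
    by (simp add: lipschitz_on_iff_LIP_le)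
qed

lemma Lip_a_le_LIP_ball:
  assumes "0 < r"
  shows "Lip_a h x \<le> LIP (ball x r) h"
proof (rule tendsto_upperbound[OF tendsto_Lip_a])
  show "\<forall>\<^sub>F s in at_right 0. LIP (ball x s) h \<le> LIP (ball x r) h"
    using assms by (auto simp: eventually_at_right_field intro!: exI[of _ r] LIP_mono subset_ball)
qed simp

lemma weak_star_convergesI:
  assumes F: "\<And>i. L-lipschitz_on UNIV (F i)" and f: "L-lipschitz_on UNIV f"
    and "\<And>x. (\<lambda>i. F i x) \<longlonglongrightarrow> f x"
  shows "weak_star_converges F f"
proof -
  have "(SUP i. LIP UNIV (F i)) \<le> ennreal L"
    using F lipschitz_on_nonneg[OF f] by (intro SUP_least) (simp flip: lipschitz_on_iff_LIP_le)
  then have "(SUP i. LIP UNIV (F i)) < \<infinity>" by (simp add: le_less_trans)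
  then show ?thesis unfolding weak_star_converges_def using assms by blast
qed

section \<open>Arc length of Lipschitz curves\<close>

definition partition_of :: "real \<Rightarrow> real \<Rightarrow> nat \<Rightarrow> (nat \<Rightarrow> real) \<Rightarrow> bool" where
  "partition_of a b n t \<longleftrightarrow> t 0 = a \<and> t n = b \<and> (\<forall>i<n. t i \<le> t (Suc i))"

definition polygon_length :: "(real \<Rightarrow> 'a::metric_space) \<Rightarrow> nat \<Rightarrow> (nat \<Rightarrow> real) \<Rightarrow> ennreal" where
  "polygon_length \<gamma> n t = (\<Sum>i<n. ennreal (dist (\<gamma> (t i)) (\<gamma> (t (Suc i)))))"

lemma curve_length_eq_SUP_polygon_length:
  "curve_length \<gamma> a b = (SUP (n, t) \<in> {(n, t). partition_of a b n t}. polygon_length \<gamma> n t)"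
  by (simp add: curve_length_def partition_of_def polygon_length_def)

lemma polygon_length_le_curve_length:
  assumes "partition_of a b n t"
  shows "polygon_length \<gamma> n t \<le> curve_length \<gamma> a b"
  unfolding curve_length_eq_SUP_polygon_length
  by (rule SUP_upper2[where i = "(n, t)"]) (use assms in auto)

lemma curve_length_least:
  assumes "\<And>n t. partition_of a b n t \<Longrightarrow> polygon_length \<gamma> n t \<le> c"
  shows "curve_length \<gamma> a b \<le> c"
  unfolding curve_length_eq_SUP_polygon_length by (rule SUP_least) (use assms in auto)

lemma partition_of_mono:
  assumes "partition_of a b n t" "i \<le> j" "j \<le> n"
  shows "t i \<le> t j"
  by (rule lift_Suc_mono_le_ivl[of "{..<n}"]) (use assms in \<open>auto simp: partition_of_def\<close>)

lemma partition_of_mem: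
  assumes "partition_of a b n t" "i \<le> n"
  shows "t i \<in> {a..b}"
  using partition_of_mono[OF assms(1), of 0 i] partition_of_mono[OF assms(1), of i n] assms
  by (auto simp: partition_of_def)

lemma curve_length_split_le:
  assumes "a \<le> s" "s \<le> b"
  shows "curve_length \<gamma> a b \<le> curve_length \<gamma> a s + curve_length \<gamma> s b"
proof (rule curve_length_least)
  fix n t assume t: "partition_of a b n t"
  define p where "p i = min (t i) s" for i
  define q where "q i = max (t i) s" for i
  have p: "partition_of a s n p" and q: "partition_of s b n q"
    using t assms by (auto simp: partition_of_def p_def q_def min_def max_def intro: order_trans)
  have "polygon_length \<gamma> n t \<le> polygon_length \<gamma> n p + polygon_length \<gamma> n q"
    unfolding polygon_length_def sum.distrib[symmetric]
  proof (rule sum_mono)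
    fix i assume "i \<in> {..<n}"
    then have "t i \<le> t (Suc i)" using t by (simp add: partition_of_def)
    then have "dist (\<gamma> (t i)) (\<gamma> (t (Suc i)))
        \<le> dist (\<gamma> (p i)) (\<gamma> (p (Suc i))) + dist (\<gamma> (q i)) (\<gamma> (q (Suc i)))"
      using dist_triangle[of "\<gamma> (t i)" "\<gamma> (t (Suc i))" "\<gamma> s"]
      by (auto simp: p_def q_def min_def max_def)
    then show "ennreal (dist (\<gamma> (t i)) (\<gamma> (t (Suc i))))
        \<le> ennreal (dist (\<gamma> (p i)) (\<gamma> (p (Suc i)))) + ennreal (dist (\<gamma> (q i)) (\<gamma> (q (Suc i))))"
      by (simp flip: ennreal_plus)
  qed
  also have "\<dots> \<le> curve_length \<gamma> a s + curve_length \<gamma> s b"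
    by (intro add_mono polygon_length_le_curve_length p q)
  finally show "polygon_length \<gamma> n t \<le> curve_length \<gamma> a s + curve_length \<gamma> s b" .
qed

lemma curve_length_add_dist_le:
  assumes "a \<le> s" "s \<le> b"
  shows "curve_length \<gamma> a s + ennreal (dist (\<gamma> s) (\<gamma> b)) \<le> curve_length \<gamma> a b"
proof -
  let ?P = "{(n, t). partition_of a s n t}"
  have "(1, \<lambda>i. if i = 0 then a else s) \<in> ?P" using assms by (auto simp: partition_of_def)
  then have "?P \<noteq> {}" by blast
  then have "curve_length \<gamma> a s + ennreal (dist (\<gamma> s) (\<gamma> b))
      = (SUP (n, t) \<in> ?P. polygon_length \<gamma> n t + ennreal (dist (\<gamma> s) (\<gamma> b)))"
    unfolding curve_length_eq_SUP_polygon_length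
    by (subst ennreal_SUP_add_left[symmetric]) (auto simp: case_prod_unfold)
  also have "\<dots> \<le> curve_length \<gamma> a b"
  proof (rule SUP_least, clarify)
    fix n t assume t: "partition_of a s n t"
    let ?t = "t(Suc n := b)"
    have "partition_of a b (Suc n) ?t"
      using t assms by (auto simp: partition_of_def less_Suc_eq)
    then have "polygon_length \<gamma> (Suc n) ?t \<le> curve_length \<gamma> a b"
      by (rule polygon_length_le_curve_length)
    moreover have "polygon_length \<gamma> (Suc n) ?t = polygon_length \<gamma> n t + ennreal (dist (\<gamma> s) (\<gamma> b))"
      using t by (simp add: polygon_length_def partition_of_def del: sum_ennreal)
    ultimately show "polygon_length \<gamma> n t + ennreal (dist (\<gamma> s) (\<gamma> b)) \<le> curve_length \<gamma> a b"
      by simp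
  qed
  finally show ?thesis .
qed

lemma curve_length_lipschitz_le:
  assumes lipschitz: "C-lipschitz_on {a..b} \<gamma>"
  shows "curve_length \<gamma> a b \<le> ennreal (C * (b - a))"
proof (rule curve_length_least)
  fix n t assume t: "partition_of a b n t"
  have "(\<Sum>i<n. dist (\<gamma> (t i)) (\<gamma> (t (Suc i)))) \<le> (\<Sum>i<n. C * (t (Suc i) - t i))"
  proof (rule sum_mono)
    fix i assume "i \<in> {..<n}"
    then have "t i \<in> {a..b}" "t (Suc i) \<in> {a..b}" "t i \<le> t (Suc i)"
      using partition_of_mem[OF t] t by (auto simp: partition_of_def)
    then show "dist (\<gamma> (t i)) (\<gamma> (t (Suc i))) \<le> C * (t (Suc i) - t i)"
      using lipschitz_onD[OF lipschitz, of "t i" "t (Suc i)"] by (simp add: dist_real_def)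
  qed
  also have "\<dots> = C * (b - a)"
    using t by (simp add: sum_lessThan_telescope partition_of_def flip: sum_distrib_left)
  finally show "polygon_length \<gamma> n t \<le> ennreal (C * (b - a))"
    by (simp add: polygon_length_def ennreal_leI)
qed

lemma image_Icc_mono_continuous:
  fixes u :: "real \<Rightarrow> real"
  assumes "mono_on {a..b} u" "continuous_on {a..b} u" "a \<le> b"
  shows "u ` {a..b} = {u a..u b}"
proof (intro equalityI subsetI)
  fix y assume "y \<in> u ` {a..b}"
  then show "y \<in> {u a..u b}" using assms(1,3) by (auto intro!: mono_onD[OF assms(1)])
next
  fix y assume "y \<in> {u a..u b}"
  then show "y \<in> u ` {a..b}" using IVT'[of u a y b] assms by auto
qed

locale lipschitz_curve =
  fixes \<gamma> :: "real \<Rightarrow> 'a::metric_space" and a b C :: real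
  assumes lipschitz: "C-lipschitz_on {a..b} \<gamma>" and a_le_b: "a \<le> b"
begin

definition arclength :: "real \<Rightarrow> real" where
  "arclength t = enn2real (curve_length \<gamma> a t)"

lemma arclength_nonneg: "0 \<le> arclength t"
  by (simp add: arclength_def)

lemma curve_length_eq_arclength:
  assumes "t \<in> {a..b}"
  shows "curve_length \<gamma> a t = ennreal (arclength t)"
proof -
  have "curve_length \<gamma> a t \<le> ennreal (C * (t - a))"
    using assms by (intro curve_length_lipschitz_le lipschitz_on_subset[OF lipschitz]) auto
  then show ?thesis
    by (simp add: arclength_def le_less_trans)
qed

lemma rectifiable_curve: "rectifiable_curve \<gamma> a b"
  unfolding rectifiable_curve_def
  using a_le_b lipschitz_on_continuous_on[OF lipschitz] by (simp add: curve_length_eq_arclength)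

lemma arclength_start: "arclength a = 0"
  using curve_length_lipschitz_le[of 0 a a \<gamma>] by (simp add: arclength_def)

lemma arclength_diff_le:
  assumes "a \<le> s" "s \<le> t" "t \<le> b"
  shows "arclength t - arclength s \<le> C * (t - s)"
proof -
  have "ennreal (arclength t) = curve_length \<gamma> a t"
    using assms by (simp add: curve_length_eq_arclength)
  also have "\<dots> \<le> curve_length \<gamma> a s + curve_length \<gamma> s t"
    using assms by (intro curve_length_split_le)
  also have "\<dots> \<le> ennreal (arclength s) + ennreal (C * (t - s))"
    using assms
    by (intro add_mono curve_length_lipschitz_le lipschitz_on_subset[OF lipschitz])
      (simp_all add: curve_length_eq_arclength)
  finally show ?thesis
    using assms arclength_nonneg lipschitz_on_nonneg[OF lipschitz] by (simp flip: ennreal_plus)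
qed

lemma dist_le_arclength_diff_ordered:
  assumes "a \<le> s" "s \<le> t" "t \<le> b"
  shows "dist (\<gamma> s) (\<gamma> t) \<le> arclength t - arclength s"
proof -
  have "ennreal (arclength s) + ennreal (dist (\<gamma> s) (\<gamma> t)) \<le> ennreal (arclength t)"
    using curve_length_add_dist_le[of a s t \<gamma>] assms by (simp add: curve_length_eq_arclength)
  then show ?thesis using arclength_nonneg by (simp flip: ennreal_plus)
qed

lemma arclength_mono: "mono_on {a..b} arclength"
proof (rule mono_onI)
  fix s t assume "s \<in> {a..b}" "t \<in> {a..b}" "s \<le> t"
  then have "dist (\<gamma> s) (\<gamma> t) \<le> arclength t - arclength s"
    by (intro dist_le_arclength_diff_ordered) auto
  then show "arclength s \<le> arclength t" using zero_le_dist[of "\<gamma> s" "\<gamma> t"] by linarith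
qed

lemma dist_le_arclength_diff:
  assumes "s \<in> {a..b}" "t \<in> {a..b}"
  shows "dist (\<gamma> s) (\<gamma> t) \<le> \<bar>arclength s - arclength t\<bar>"
  using assms dist_le_arclength_diff_ordered[of s t] dist_le_arclength_diff_ordered[of t s]
  by (cases "s \<le> t") (auto simp: dist_commute)

lemma lipschitz_on_arclength: "C-lipschitz_on {a..b} arclength"
proof (rule lipschitz_on_leI)
  fix s t assume "s \<in> {a..b}" "t \<in> {a..b}" "s \<le> t"
  then show "dist (arclength s) (arclength t) \<le> C * dist s t"
    using arclength_diff_le[of s t] mono_onD[OF arclength_mono, of s t]
    by (auto simp: dist_real_def)
qed (rule lipschitz_on_nonneg[OF lipschitz])

lemma arclength_image: "arclength ` {a..b} = {0..arclength b}"
  using image_Icc_mono_continuous[OF arclength_mono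
      lipschitz_on_continuous_on[OF lipschitz_on_arclength] a_le_b]
  by (simp add: arclength_start)

lemma arclength_param_arclength:
  assumes "t \<in> {a..b}"
  shows "arclength_param \<gamma> a b (arclength t) = \<gamma> t"
proof -
  define r where "r = (SOME r. r \<in> {a..b} \<and> curve_length \<gamma> a r = ennreal (arclength t))"
  have "r \<in> {a..b} \<and> curve_length \<gamma> a r = ennreal (arclength t)"
    unfolding r_def by (rule someI[of _ t]) (use assms curve_length_eq_arclength in simp)
  then have "r \<in> {a..b}" "arclength r = arclength t"
    by (auto simp: curve_length_eq_arclength arclength_nonneg)
  then have "\<gamma> r = \<gamma> t" using dist_le_arclength_diff[of r t] assms by simp
  then show ?thesis unfolding arclength_param_def r_def .
qed

lemma lipschitz_on_arclength_param: "1-lipschitz_on {0..arclength b} (arclength_param \<gamma> a b)"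
  unfolding arclength_image[symmetric]
proof (rule lipschitz_onI)
  fix x y assume "x \<in> arclength ` {a..b}" "y \<in> arclength ` {a..b}"
  then show "dist (arclength_param \<gamma> a b x) (arclength_param \<gamma> a b y) \<le> 1 * dist x y"
    using dist_le_arclength_diff by (auto simp: arclength_param_arclength dist_real_def)
qed simp

end

section \<open>Line integrals along Lipschitz curves\<close>

context
  fixes u H :: "real \<Rightarrow> real" and a b C :: real
  assumes u_mono: "mono_on {a..b} u" and u_lipschitz: "C-lipschitz_on {a..b} u"
    and H_cont: "continuous_on {u a..u b} H" and H_nonneg: "\<And>x. x \<in> {u a..u b} \<Longrightarrow> 0 \<le> H x"
begin

lemma reparam_integrable:
  assumes "a \<le> s" "s \<le> t" "t \<le> b"
  shows "H integrable_on {u s..u t}" "(\<lambda>r. H (u r)) integrable_on {s..t}"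
proof -
  have "{u s..u t} \<subseteq> {u a..u b}" "u ` {s..t} \<subseteq> {u a..u b}"
    using assms by (auto intro!: mono_onD[OF u_mono] order_trans[OF mono_onD[OF u_mono]]
        order_trans[OF _ mono_onD[OF u_mono]])
  moreover have "continuous_on {s..t} u"
    using assms by (intro continuous_on_subset[OF lipschitz_on_continuous_on[OF u_lipschitz]]) auto
  ultimately show "H integrable_on {u s..u t}" "(\<lambda>r. H (u r)) integrable_on {s..t}"
    by (auto intro!: integrable_continuous_interval continuous_on_subset[OF H_cont]
        continuous_on_compose2[OF H_cont])
qed

lemma integral_reparam_le_of_oscillation:
  assumes "a \<le> s" "s \<le> x" "x \<le> t" "t \<le> b" "0 < e"
    and osc: "\<And>r. r \<in> {s..t} \<Longrightarrow> H (u x) - e \<le> H (u r) \<and> H (u r) \<le> H (u x) + e"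
  shows "integral {u s..u t} H \<le> C * integral {s..t} (\<lambda>r. H (u r)) + 2 * C * e * (t - s)"
proof -
  have "s \<le> t" using assms by simp
  have "integral {u s..u t} H \<le> integral {u s..u t} (\<lambda>_. H (u x) + e)"
  proof (rule integral_le)
    fix y assume "y \<in> {u s..u t}"
    also have "{u s..u t} = u ` {s..t}"
      using assms
      by (intro image_Icc_mono_continuous[symmetric] mono_on_subset[OF u_mono]
          continuous_on_subset[OF lipschitz_on_continuous_on[OF u_lipschitz]]) auto
    finally show "H y \<le> H (u x) + e" using osc by auto
  qed (use assms reparam_integrable in auto)
  also have "\<dots> = (u t - u s) * (H (u x) + e)"
    using assms mono_onD[OF u_mono, of s t] by simp
  also have "\<dots> \<le> C * (t - s) * (H (u x) + e)"
    using assms lipschitz_onD[OF u_lipschitz, of t s] H_nonneg[of "u x"]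
      mono_onD[OF u_mono, of a x] mono_onD[OF u_mono, of x b]
    by (intro mult_right_mono) (auto simp: dist_real_def)
  also have "\<dots> = C * integral {s..t} (\<lambda>_. H (u x) - e) + 2 * C * e * (t - s)"
    using \<open>s \<le> t\<close> by (simp add: algebra_simps)
  also have "integral {s..t} (\<lambda>_. H (u x) - e) \<le> integral {s..t} (\<lambda>r. H (u r))"
    using assms osc by (intro integral_le reparam_integrable) auto
  finally show ?thesis
    using lipschitz_on_nonneg[OF u_lipschitz] by (simp add: mult_left_mono)
qed

lemma integral_reparam_lipschitz_le_approx:
  assumes "a \<le> b" "0 < e"
  shows "integral {u a..u b} H \<le> C * integral {a..b} (\<lambda>t. H (u t)) + 2 * C * e * (b - a)"
proof -
  define P where "P s t \<longleftrightarrow> (a \<le> s \<longrightarrow> t \<le> b \<longrightarrow>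
    integral {u s..u t} H \<le> C * integral {s..t} (\<lambda>r. H (u r)) + 2 * C * e * (t - s))" for s t
  from \<open>a \<le> b\<close> have "P a b"
  proof (induction rule: Bolzano)
    case (trans r s t)
    show ?case
      unfolding P_def
    proof (intro impI)
      assume "a \<le> r" "t \<le> b"
      then have "integral {u r..u t} H = integral {u r..u s} H + integral {u s..u t} H"
        "integral {r..t} (\<lambda>q. H (u q))
          = integral {r..s} (\<lambda>q. H (u q)) + integral {s..t} (\<lambda>q. H (u q))"
        using trans(3,4)
        by (auto intro!: Henstock_Kurzweil_Integration.integral_combine[symmetric]
            reparam_integrable mono_onD[OF u_mono])
      then show "integral {u r..u t} H \<le> C * integral {r..t} (\<lambda>q. H (u q)) + 2 * C * e * (t - r)"
        using trans \<open>a \<le> r\<close> \<open>t \<le> b\<close> by (simp add: P_def algebra_simps)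
    qed
  next
    case (local x)
    have "continuous_on {a..b} (\<lambda>r. H (u r))"
      by (rule continuous_on_compose2[OF H_cont lipschitz_on_continuous_on[OF u_lipschitz]])
        (auto intro!: mono_onD[OF u_mono])
    with local \<open>0 < e\<close> obtain d where "d > 0"
      and d: "\<And>r. r \<in> {a..b} \<Longrightarrow> \<bar>r - x\<bar> < d \<Longrightarrow> \<bar>H (u r) - H (u x)\<bar> < e"
      unfolding continuous_on_iff dist_real_def by (metis atLeastAtMost_iff)
    have "H (u x) - e \<le> H (u r) \<and> H (u r) \<le> H (u x) + e"
      if "a \<le> s" "s \<le> x" "x \<le> t" "t \<le> b" "t - s < d" "r \<in> {s..t}" for s t r
    proof -
      have "\<bar>r - x\<bar> < d" using that by auto
      then show ?thesis using d[of r] that by auto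
    qed
    then have "\<forall>s t. s \<le> x \<and> x \<le> t \<and> t - s < d \<longrightarrow> P s t"
      unfolding P_def using \<open>0 < e\<close> by (blast intro: integral_reparam_le_of_oscillation)
    with \<open>d > 0\<close> show ?case by blast
  qed
  then show ?thesis by (simp add: P_def)
qed

lemma integral_reparam_lipschitz_le:
  assumes "a \<le> b"
  shows "integral {u a..u b} H \<le> C * integral {a..b} (\<lambda>t. H (u t))"
proof (rule field_le_epsilon)
  fix e :: real assume "e > 0"
  define k where "k = 2 * C * (b - a)"
  have "0 \<le> k" using assms lipschitz_on_nonneg[OF u_lipschitz] by (simp add: k_def)
  then have "k * (e / (k + 1)) \<le> e" "e / (k + 1) > 0"
    using \<open>e > 0\<close> by (simp_all add: field_simps)
  then show "integral {u a..u b} H \<le> C * integral {a..b} (\<lambda>t. H (u t)) + e"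
    using integral_reparam_lipschitz_le_approx[OF assms, of "e / (k + 1)"]
    by (simp add: k_def algebra_simps)
qed

end

context lipschitz_curve
begin

lemma line_integral_le:
  assumes h: "continuous_on UNIV h" "\<And>x. 0 \<le> h x"
  shows "line_integral \<gamma> a b (\<lambda>x. ennreal (h x)) \<le> ennreal (C * integral {a..b} (\<lambda>t. h (\<gamma> t)))"
proof -
  let ?H = "\<lambda>s. h (arclength_param \<gamma> a b s)"
  have cont: "continuous_on {0..arclength b} ?H"
    using h(1) lipschitz_on_continuous_on[OF lipschitz_on_arclength_param]
    by (rule continuous_on_compose2) simp
  have "line_integral \<gamma> a b (\<lambda>x. ennreal (h x)) = ennreal (integral {0..arclength b} ?H)"
    unfolding line_integral_def arclength_def[symmetric]
    by (intro nn_integral_has_integral_lebesgue' h integrable_integral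
        integrable_continuous_interval cont)
  also have "integral {0..arclength b} ?H \<le> C * integral {a..b} (\<lambda>t. ?H (arclength t))"
    using integral_reparam_lipschitz_le[OF arclength_mono lipschitz_on_arclength, of ?H]
      cont h(2) a_le_b
    by (simp add: arclength_start)
  also have "integral {a..b} (\<lambda>t. ?H (arclength t)) = integral {a..b} (\<lambda>t. h (\<gamma> t))"
    by (rule integral_cong) (simp add: arclength_param_arclength)
  finally show ?thesis by (simp add: ennreal_leI)
qed

lemma line_integral_SUP:
  fixes G :: "nat \<Rightarrow> 'a \<Rightarrow> ennreal"
  assumes "incseq G" and G: "\<And>j. G j \<in> borel_measurable borel"
  shows "line_integral \<gamma> a b (\<lambda>x. SUP j. G j x) = (SUP j. line_integral \<gamma> a b (G j))"
proof -
  let ?\<sigma> = "arclength_param \<gamma> a b" and ?M = "restrict_space lborel {0..arclength b}"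
  have line_integral: "line_integral \<gamma> a b g = (\<integral>\<^sup>+ s. g (?\<sigma> s) \<partial>?M)" for g
    by (simp add: line_integral_def nn_integral_restrict_space flip: arclength_def)
  have "?\<sigma> \<in> borel_measurable (restrict_space borel {0..arclength b})"
    by (intro borel_measurable_continuous_on_restrict
        lipschitz_on_continuous_on[OF lipschitz_on_arclength_param])
  then have "?\<sigma> \<in> borel_measurable ?M"
    by (simp cong: measurable_cong_sets add: sets_restrict_space)
  then have "(\<lambda>s. G j (?\<sigma> s)) \<in> borel_measurable ?M" for j
    using G by (rule measurable_compose)
  moreover have "incseq (\<lambda>j s. G j (?\<sigma> s))"
    using \<open>incseq G\<close> by (simp add: incseq_def le_fun_def)
  ultimately show ?thesis
    unfolding line_integral by (intro nn_integral_monotone_convergence_SUP)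
qed

lemma upper_gradient_bound:
  assumes ug: "upper_gradient (\<lambda>x. ennreal (g x)) f"
    and gs: "\<And>j. continuous_on UNIV (gs j)" "\<And>j x. 0 \<le> gs j x"
    and mono: "\<And>j x. gs j x \<le> gs (Suc j) x" and lim: "\<And>x. (\<lambda>j. gs j x) \<longlonglongrightarrow> g x"
    and bound: "\<And>j. C * integral {a..b} (\<lambda>t. gs j (\<gamma> t)) \<le> B"
  shows "\<bar>f (\<gamma> a) - f (\<gamma> b)\<bar> \<le> B"
proof -
  have inc: "incseq (\<lambda>j x. ennreal (gs j x))"
    using mono by (intro incseq_SucI le_funI ennreal_leI)
  have "ennreal (g x) = (SUP j. ennreal (gs j x))" for x
  proof (rule LIMSEQ_unique)
    show "(\<lambda>j. ennreal (gs j x)) \<longlonglongrightarrow> ennreal (g x)" by (intro tendsto_ennrealI lim)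
    show "(\<lambda>j. ennreal (gs j x)) \<longlonglongrightarrow> (SUP j. ennreal (gs j x))"
      using inc by (intro LIMSEQ_SUP) (simp add: incseq_def le_fun_def)
  qed
  moreover have "(\<lambda>x. ennreal (gs j x)) \<in> borel_measurable borel" for j
    using borel_measurable_continuous_onI[OF gs(1)] by simp
  ultimately have "line_integral \<gamma> a b (\<lambda>x. ennreal (g x))
      = (SUP j. line_integral \<gamma> a b (\<lambda>x. ennreal (gs j x)))"
    using inc by (simp add: line_integral_SUP)
  also have "\<dots> \<le> ennreal B"
    using line_integral_le[OF gs] bound by (intro SUP_least) (meson ennreal_leI order_trans)
  finally have "ennreal \<bar>f (\<gamma> a) - f (\<gamma> b)\<bar> \<le> ennreal B"
    using ug rectifiable_curve unfolding upper_gradient_def by (meson order_trans)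
  moreover have "0 \<le> C * integral {a..b} (\<lambda>t. gs 0 (\<gamma> t))"
    using gs lipschitz_on_nonneg[OF lipschitz] lipschitz_on_continuous_on[OF lipschitz]
    by (intro mult_nonneg_nonneg integral_nonneg integrable_continuous_interval)
      (auto intro: continuous_on_compose2[OF gs(1)])
  ultimately show ?thesis
    using bound[of 0] by simp
qed

end

section \<open>Costs of curves\<close>

text \<open>Curves are 1-Lipschitz rather than parametrized by arc length:
  the former is stable under pointwise limits.\<close>

definition curve_from :: "'a::metric_space \<Rightarrow> real \<Rightarrow> (real \<Rightarrow> 'a) \<Rightarrow> bool" where
  "curve_from x T \<gamma> \<longleftrightarrow> 0 \<le> T \<and> 1-lipschitz_on {0..T} \<gamma> \<and> \<gamma> 0 = x"

definition curve_cost :: "('a \<Rightarrow> real) \<Rightarrow> ('a \<Rightarrow> real) \<Rightarrow> real \<Rightarrow> (real \<Rightarrow> 'a) \<Rightarrow> real" where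
  "curve_cost f h T \<gamma> = f (\<gamma> T) + integral {0..T} (\<lambda>s. h (\<gamma> s))"

lemma integrable_along_lipschitz_curve:
  fixes h :: "'a::metric_space \<Rightarrow> real"
  assumes "continuous_on UNIV h" "C-lipschitz_on {a..b} \<gamma>"
  shows "(\<lambda>s. h (\<gamma> s)) integrable_on {a..b::real}"
  by (intro integrable_continuous_interval
      continuous_on_compose2[OF assms(1) lipschitz_on_continuous_on[OF assms(2)]]) simp

lemma curve_from_stop:
  assumes "curve_from x T \<gamma>" "0 \<le> t" "t \<le> T"
  shows "curve_from x t \<gamma>"
  using assms by (auto simp: curve_from_def intro: lipschitz_on_subset)

lemma curve_cost_split:
  assumes \<gamma>: "curve_from x T \<gamma>" and t: "0 \<le> t" "t \<le> T" and h: "continuous_on UNIV h"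
  shows "curve_cost f h T \<gamma>
    = integral {0..t} (\<lambda>s. h (\<gamma> s)) + f (\<gamma> T) + integral {t..T} (\<lambda>s. h (\<gamma> s))"
proof -
  have "(\<lambda>s. h (\<gamma> s)) integrable_on {0..T}"
    using \<gamma> by (auto simp: curve_from_def intro: integrable_along_lipschitz_curve[OF h])
  then show ?thesis
    unfolding curve_cost_def
    by (simp flip: Henstock_Kurzweil_Integration.integral_combine[OF t])
qed

definition join_curves :: "real \<Rightarrow> (real \<Rightarrow> 'a) \<Rightarrow> (real \<Rightarrow> 'a) \<Rightarrow> real \<Rightarrow> 'a" where
  "join_curves d \<alpha> \<gamma> s = (if s \<le> d then \<alpha> s else \<gamma> (s - d))"

lemma curve_from_join_curves:
  assumes \<alpha>: "curve_from x d \<alpha>" and \<gamma>: "curve_from (\<alpha> d) T \<gamma>"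
  shows "curve_from x (d + T) (join_curves d \<alpha> \<gamma>)"
proof -
  have "1-lipschitz_on {d..d + T} (\<lambda>s. \<gamma> (s - d))"
  proof (rule lipschitz_onI)
    fix s t assume "s \<in> {d..d + T}" "t \<in> {d..d + T}"
    then show "dist (\<gamma> (s - d)) (\<gamma> (t - d)) \<le> 1 * dist s t"
      using \<gamma> lipschitz_onD[of 1 "{0..T}" \<gamma> "s - d" "t - d"]
      by (auto simp: curve_from_def dist_real_def)
  qed simp
  then have "1-lipschitz_on {0..d + T} (join_curves d \<alpha> \<gamma>)"
    unfolding join_curves_def using \<alpha> \<gamma>
    by (intro lipschitz_on_concat) (auto simp: curve_from_def)
  then show ?thesis
    using \<alpha> \<gamma> by (simp add: curve_from_def join_curves_def)
qed

lemma curve_cost_join_curves: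
  assumes \<alpha>: "curve_from x d \<alpha>" and \<gamma>: "curve_from (\<alpha> d) T \<gamma>" and h: "continuous_on UNIV h"
  shows "curve_cost f h (d + T) (join_curves d \<alpha> \<gamma>)
    = integral {0..d} (\<lambda>s. h (\<alpha> s)) + curve_cost f h T \<gamma>"
proof -
  let ?\<beta> = "join_curves d \<alpha> \<gamma>"
  have T: "0 \<le> d" "0 \<le> T" and \<gamma>0: "\<gamma> 0 = \<alpha> d" using \<alpha> \<gamma> by (auto simp: curve_from_def)
  have end_point: "?\<beta> (d + s) = \<gamma> s" if "0 \<le> s" for s
    using that \<gamma>0 by (auto simp: join_curves_def)
  have "curve_cost f h (d + T) ?\<beta>
      = integral {0..d} (\<lambda>s. h (?\<beta> s)) + f (?\<beta> (d + T)) + integral {d..d + T} (\<lambda>s. h (?\<beta> s))"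
    using T by (intro curve_cost_split[OF curve_from_join_curves[OF \<alpha> \<gamma>] _ _ h]) auto
  also have "integral {0..d} (\<lambda>s. h (?\<beta> s)) = integral {0..d} (\<lambda>s. h (\<alpha> s))"
    by (rule integral_cong) (simp add: join_curves_def)
  also have "integral {d..d + T} (\<lambda>s. h (?\<beta> s)) = integral {0..T} ((\<lambda>s. h (?\<beta> s)) \<circ> (+) d)"
    by (simp add: integral_shift_Icc_real add.commute)
  also have "\<dots> = integral {0..T} (\<lambda>s. h (\<gamma> s))"
    by (rule integral_cong) (simp add: end_point)
  finally show ?thesis using T by (simp add: end_point curve_cost_def)
qed

lemma segment_curve_from:
  fixes u v :: "'a::real_normed_vector"
  shows "curve_from u (dist u v) (\<lambda>s. linepath u v (s / dist u v))"
proof -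
  have "linepath u v (s / dist u v) - linepath u v (t / dist u v)
      = ((s - t) / dist u v) *\<^sub>R (v - u)" for s t
    by (simp add: linepath_def algebra_simps diff_divide_distrib)
  then have "dist (linepath u v (s / dist u v)) (linepath u v (t / dist u v)) \<le> dist s t" for s t
    by (simp add: dist_norm norm_minus_commute)
  then show ?thesis by (auto simp: curve_from_def intro!: lipschitz_onI simp: linepath_def)
qed

lemma rescale_curve_from:
  assumes "curve_from x T \<gamma>"
  shows "T-lipschitz_on {0..1} (\<lambda>s. \<gamma> (T * s))"
proof (rule lipschitz_onI)
  fix s t :: real assume "s \<in> {0..1}" "t \<in> {0..1}"
  then have "T * s \<in> {0..T}" "T * t \<in> {0..T}"
    using assms by (auto simp: curve_from_def mult_left_le)
  then have "dist (\<gamma> (T * s)) (\<gamma> (T * t)) \<le> 1 * dist (T * s) (T * t)"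
    using assms unfolding curve_from_def by (meson lipschitz_onD)
  then show "dist (\<gamma> (T * s)) (\<gamma> (T * t)) \<le> T * dist s t"
    using assms by (simp add: curve_from_def dist_real_def abs_mult flip: right_diff_distrib)
qed (use assms in \<open>simp add: curve_from_def\<close>)

lemma rescale_curve_from_mem_cball:
  assumes "curve_from x T \<gamma>" "s \<in> {0..1}"
  shows "\<gamma> (T * s) \<in> cball x T"
proof -
  have "0 \<le> T" "\<gamma> 0 = x" using assms(1) by (auto simp: curve_from_def)
  then have "dist x (\<gamma> (T * s)) \<le> T * s"
    using lipschitz_onD[OF rescale_curve_from[OF assms(1)], of 0 s] assms(2)
    by (simp add: dist_real_def)
  also have "\<dots> \<le> T" using assms(2) \<open>0 \<le> T\<close> by (simp add: mult_left_le)
  finally show ?thesis by simp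
qed

lemma curve_cost_rescale:
  assumes \<gamma>: "curve_from x T \<gamma>" and h: "continuous_on UNIV h"
  shows "curve_cost f h T \<gamma> = f (\<gamma> T) + T * integral {0..1} (\<lambda>s. h (\<gamma> (T * s)))"
proof -
  have "continuous_on {0..T} (\<lambda>s. h (\<gamma> s))"
    using \<gamma> lipschitz_on_continuous_on
    by (intro continuous_on_compose2[OF h]) (auto simp: curve_from_def)
  then have "((\<lambda>s. T *\<^sub>R h (\<gamma> (T * s))) has_integral integral {T * 0..T * 1} (\<lambda>s. h (\<gamma> s))) {0..1}"
    using \<gamma>
    by (intro has_integral_substitution[where c = 0 and d = T])
      (auto simp: curve_from_def mult_left_le intro!: derivative_eq_intros)
  then show ?thesis unfolding curve_cost_def by (auto dest!: integral_unique)
qed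

section \<open>Compactness of families of curves\<close>

lemma lipschitz_on_LIMSEQ:
  assumes lipschitz: "\<And>i. (C i)-lipschitz_on S (F i)" and C: "C \<longlonglongrightarrow> c"
    and F: "\<And>s. s \<in> S \<Longrightarrow> (\<lambda>i. F i s) \<longlonglongrightarrow> G s"
  shows "c-lipschitz_on S G"
proof (rule lipschitz_onI)
  fix s t assume st: "s \<in> S" "t \<in> S"
  have "(\<lambda>i. dist (F i s) (F i t)) \<longlonglongrightarrow> dist (G s) (G t)" "(\<lambda>i. C i * dist s t) \<longlonglongrightarrow> c * dist s t"
    by (intro tendsto_intros C F st)+
  then show "dist (G s) (G t) \<le> c * dist s t"
    by (rule LIMSEQ_le) (use lipschitz_onD[OF lipschitz st] in blast)
next
  show "0 \<le> c" by (rule LIMSEQ_le_const[OF C]) (auto intro: lipschitz_on_nonneg[OF lipschitz])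
qed

lemma Arzela_Ascoli_lipschitz:
  fixes F :: "nat \<Rightarrow> 'a::euclidean_space \<Rightarrow> 'b::{real_normed_vector,heine_borel}"
  assumes "compact S" and lipschitz: "\<And>i. M-lipschitz_on S (F i)"
    and norm_le: "\<And>i s. s \<in> S \<Longrightarrow> norm (F i s) \<le> B"
  obtains r G where "strict_mono (r :: nat \<Rightarrow> nat)" "\<And>s. s \<in> S \<Longrightarrow> (\<lambda>i. F (r i) s) \<longlonglongrightarrow> G s"
proof -
  have equicontinuous: "\<exists>d>0. \<forall>i t. t \<in> S \<and> norm (s - t) < d \<longrightarrow> norm (F i s - F i t) < e"
    if "s \<in> S" "0 < e" for s e
  proof (intro exI[of _ "e / (M + 1)"] conjI allI impI)
    have M: "0 \<le> M" by (rule lipschitz_on_nonneg[OF lipschitz])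
    then show "0 < e / (M + 1)" using \<open>0 < e\<close> by simp
    fix i t assume t: "t \<in> S \<and> norm (s - t) < e / (M + 1)"
    have "norm (F i s - F i t) \<le> M * norm (s - t)"
      using lipschitz_onD[OF lipschitz] t \<open>s \<in> S\<close> by (simp add: dist_norm)
    also have "\<dots> \<le> (M + 1) * norm (s - t)" by (simp add: mult_right_mono)
    also have "\<dots> < e" using t M by (simp add: pos_less_divide_eq mult.commute)
    finally show "norm (F i s - F i t) < e" .
  qed
  show thesis
  proof (rule Arzela_Ascoli[OF \<open>compact S\<close> norm_le equicontinuous])
    fix G and r :: "nat \<Rightarrow> nat"
    assume "strict_mono r" and G: "\<And>e. 0 < e \<Longrightarrow> \<exists>N. \<forall>i s. N \<le> i \<and> s \<in> S \<longrightarrow> norm (F (r i) s - G s) < e"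
    moreover have "(\<lambda>i. F (r i) s) \<longlonglongrightarrow> G s" if "s \<in> S" for s
      using G that by (intro LIMSEQ_I) meson
    ultimately show thesis using that by blast
  qed
qed

lemma integral_compose_tendsto:
  fixes h :: "'a::metric_space \<Rightarrow> real" and \<phi> :: "nat \<Rightarrow> real \<Rightarrow> 'a"
  assumes h: "continuous_on UNIV h" and "compact S"
    and \<phi>: "\<And>i. continuous_on {a..b} (\<phi> i)" "\<And>i s. s \<in> {a..b} \<Longrightarrow> \<phi> i s \<in> S"
    and lim: "\<And>s. s \<in> {a..b} \<Longrightarrow> (\<lambda>i. \<phi> i s) \<longlonglongrightarrow> \<psi> s"
  shows "(\<lambda>i. integral {a..b} (\<lambda>s. h (\<phi> i s))) \<longlonglongrightarrow> integral {a..b} (\<lambda>s. h (\<psi> s))"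
proof -
  have "bounded (h ` S)"
    using \<open>compact S\<close> continuous_on_subset[OF h]
    by (intro compact_imp_bounded compact_continuous_image) auto
  then obtain B where B: "\<And>y. y \<in> S \<Longrightarrow> norm (h y) \<le> B"
    by (auto simp: bounded_iff)
  show ?thesis
  proof (rule dominated_convergence(2)[where h = "\<lambda>_. B"])
    show "(\<lambda>s. h (\<phi> i s)) integrable_on {a..b}" for i
      by (intro integrable_continuous_interval continuous_on_compose2[OF h \<phi>(1)]) simp
    show "(\<lambda>i. h (\<phi> i s)) \<longlonglongrightarrow> h (\<psi> s)" if "s \<in> {a..b}" for s
      by (rule continuous_on_tendsto_compose[OF h lim[OF that]]) auto
  qed (use B \<phi>(2) in auto)
qed

text \<open>The limit curve is rescaled to \<open>[0,1]\<close>, so that the durations \<open>T\<^sub>i\<close> may vary.\<close>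

lemma curves_from_subsequence:
  fixes \<gamma> :: "nat \<Rightarrow> real \<Rightarrow> 'a::{real_normed_vector,heine_borel}"
  assumes \<gamma>: "\<And>i. curve_from x (T i) (\<gamma> i)" and "\<And>i. T i \<le> M"
  obtains r \<eta> C where "strict_mono (r :: nat \<Rightarrow> nat)" "C-lipschitz_on {0..1::real} \<eta>" "\<eta> 0 = x"
    "\<And>f h. continuous_on UNIV f \<Longrightarrow> continuous_on UNIV h \<Longrightarrow>
      (\<lambda>i. curve_cost f h (T (r i)) (\<gamma> (r i))) \<longlonglongrightarrow> f (\<eta> 1) + C * integral {0..1} (\<lambda>s. h (\<eta> s))"
proof -
  have T: "T i \<in> {0..M}" for i using assms by (simp add: curve_from_def)
  define \<phi> where "\<phi> i s = \<gamma> i (T i * s)" for i s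
  have \<phi>: "(T i)-lipschitz_on {0..1} (\<phi> i)" for i
    unfolding \<phi>_def by (rule rescale_curve_from[OF \<gamma>])
  have start: "\<phi> i 0 = x" for i using \<gamma> by (simp add: \<phi>_def curve_from_def)
  have \<phi>_ball: "\<phi> i s \<in> cball x M" if "s \<in> {0..1}" for i s
    using rescale_curve_from_mem_cball[OF \<gamma> that, of i] T[of i] by (simp add: \<phi>_def)
  obtain C p where p: "strict_mono p" "(\<lambda>i. T (p i)) \<longlonglongrightarrow> C"
    using compact_imp_seq_compact[OF compact_Icc] T unfolding seq_compact_def o_def by metis
  have "M-lipschitz_on {0..1} (\<phi> (p i))" for i
    using \<phi>[of "p i"] T[of "p i"] by (auto intro: lipschitz_on_le)
  moreover have "norm (\<phi> (p i) s) \<le> norm x + M" if "s \<in> {0..1}" for i s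
    using \<phi>_ball[OF that, of "p i"] norm_triangle_sub[of "\<phi> (p i) s" x]
    by (simp add: dist_norm norm_minus_commute)
  ultimately obtain q \<eta> where q: "strict_mono q"
    and \<eta>: "\<And>s. s \<in> {0..1} \<Longrightarrow> (\<lambda>i. \<phi> (p (q i)) s) \<longlonglongrightarrow> \<eta> s"
    using Arzela_Ascoli_lipschitz[of "{0..1::real}" M "\<lambda>i. \<phi> (p i)" "norm x + M"]
    by (metis compact_Icc)
  have C: "(\<lambda>i. T (p (q i))) \<longlonglongrightarrow> C"
    using LIMSEQ_subseq_LIMSEQ[OF p(2) q] by (simp add: o_def)
  show thesis
  proof (rule that[of "p \<circ> q" C \<eta>])
    show "strict_mono (p \<circ> q)" using p(1) q by (rule strict_mono_o)
    show "C-lipschitz_on {0..1} \<eta>" by (rule lipschitz_on_LIMSEQ[OF \<phi> C \<eta>])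
    show "\<eta> 0 = x" using \<eta>[of 0] by (simp add: start LIMSEQ_const_iff)
    fix f h :: "'a \<Rightarrow> real" assume f: "continuous_on UNIV f" and h: "continuous_on UNIV h"
    have "(\<lambda>i. f (\<phi> (p (q i)) 1)) \<longlonglongrightarrow> f (\<eta> 1)"
      by (rule continuous_on_tendsto_compose[OF f \<eta>]) auto
    moreover have "(\<lambda>i. integral {0..1} (\<lambda>s. h (\<phi> (p (q i)) s))) \<longlonglongrightarrow> integral {0..1} (\<lambda>s. h (\<eta> s))"
      by (rule integral_compose_tendsto[OF h compact_cball
          lipschitz_on_continuous_on[OF \<phi>] \<phi>_ball \<eta>])
    ultimately show "(\<lambda>i. curve_cost f h (T ((p \<circ> q) i)) (\<gamma> ((p \<circ> q) i)))
        \<longlonglongrightarrow> f (\<eta> 1) + C * integral {0..1} (\<lambda>s. h (\<eta> s))"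
      unfolding curve_cost_rescale[OF \<gamma> h] using C by (auto simp: \<phi>_def intro!: tendsto_intros)
  qed
qed

section \<open>The infimal cost\<close>

definition eikonal_envelope :: "('a::metric_space \<Rightarrow> real) \<Rightarrow> ('a \<Rightarrow> real) \<Rightarrow> 'a \<Rightarrow> real" where
  "eikonal_envelope f h x = Inf {curve_cost f h T \<gamma> | T \<gamma>. curve_from x T \<gamma>}"

lemma constant_curve_from: "curve_from x 0 (\<lambda>_. x)"
  by (simp add: curve_from_def)

lemma eikonal_envelope_greatest:
  assumes "\<And>T \<gamma>. curve_from x T \<gamma> \<Longrightarrow> c \<le> curve_cost f h T \<gamma>"
  shows "c \<le> eikonal_envelope f h x"
  unfolding eikonal_envelope_def
proof (rule cInf_greatest)
  show "{curve_cost f h T \<gamma> | T \<gamma>. curve_from x T \<gamma>} \<noteq> {}" using constant_curve_from by blast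
qed (use assms in auto)

lemma eikonal_envelope_lessD:
  assumes "eikonal_envelope f h x < c"
  obtains T \<gamma> where "curve_from x T \<gamma>" "curve_cost f h T \<gamma> < c"
  using assms eikonal_envelope_greatest[of x c f h] by (meson linorder_not_less)

locale eikonal =
  fixes f h :: "'a::real_normed_vector \<Rightarrow> real" and L :: real and K :: "'a set"
  assumes f_lipschitz: "L-lipschitz_on UNIV f" and compact_K: "compact K"
    and h_continuous: "continuous_on UNIV h" and h_nonneg: "\<And>x. 0 \<le> h x"
    and h_outside: "\<And>x. x \<notin> K \<Longrightarrow> L \<le> h x"
begin

lemma integrable_along_curve:
  "1-lipschitz_on {a..b::real} \<gamma> \<Longrightarrow> (\<lambda>s. h (\<gamma> s)) integrable_on {a..b}"
  by (rule integrable_along_lipschitz_curve[OF h_continuous])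

lemma f_start_le_of_outside:
  fixes a b :: real
  assumes \<gamma>: "1-lipschitz_on {a..b} \<gamma>" and "a \<le> b"
    and outside: "\<And>t. a < t \<Longrightarrow> t \<le> b \<Longrightarrow> \<gamma> t \<notin> K"
  shows "f (\<gamma> a) \<le> f (\<gamma> b) + integral {a..b} (\<lambda>s. h (\<gamma> s))"
proof -
  have "f (\<gamma> a) - f (\<gamma> b) \<le> L * dist (\<gamma> a) (\<gamma> b)"
    using lipschitz_onD[OF f_lipschitz, of "\<gamma> a" "\<gamma> b"] by (simp add: dist_real_def)
  also have "\<dots> \<le> L * (b - a)"
    using lipschitz_onD[OF \<gamma>, of a b] \<open>a \<le> b\<close> lipschitz_on_nonneg[OF f_lipschitz]
    by (intro mult_left_mono) (auto simp: dist_real_def)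
  also have "\<dots> = integral {a<..<b} (\<lambda>_. L)"
    using \<open>a \<le> b\<close> by (simp flip: integral_open_interval_real)
  also have "\<dots> \<le> integral {a<..<b} (\<lambda>s. h (\<gamma> s))"
    using integrable_along_curve[OF \<gamma>] outside
    by (intro integral_le) (auto simp: integrable_on_open_interval_real intro: h_outside)
  also have "\<dots> = integral {a..b} (\<lambda>s. h (\<gamma> s))"
    by (rule integral_open_interval_real[symmetric])
  finally show ?thesis by simp
qed

lemma curve_last_visit:
  assumes \<gamma>: "curve_from x T \<gamma>"
  obtains (never) "f x \<le> curve_cost f h T \<gamma>"
  | (visit) \<tau> where "curve_from x \<tau> \<gamma>" "\<gamma> \<tau> \<in> K" "curve_cost f h \<tau> \<gamma> \<le> curve_cost f h T \<gamma>"
proof -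
  have T: "0 \<le> T" and lipschitz: "1-lipschitz_on {0..T} \<gamma>" and start: "\<gamma> 0 = x"
    using \<gamma> by (auto simp: curve_from_def)
  define V where "V = {0..T} \<inter> \<gamma> -` K"
  show thesis
  proof (cases "V = {}")
    case True
    then have "f (\<gamma> 0) \<le> f (\<gamma> T) + integral {0..T} (\<lambda>s. h (\<gamma> s))"
      by (intro f_start_le_of_outside[OF lipschitz T]) (auto simp: V_def disjoint_iff)
    then show thesis using that(1) start by (simp add: curve_cost_def)
  next
    case False
    have "compact V"
      using continuous_closed_preimage[OF lipschitz_on_continuous_on[OF lipschitz] _
          compact_imp_closed[OF compact_K]]
      by (auto simp: V_def compact_eq_bounded_closed
          intro: bounded_subset[OF bounded_closed_interval])
    with False obtain \<tau> where "\<tau> \<in> V" and last: "\<And>t. t \<in> V \<Longrightarrow> t \<le> \<tau>"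
      by (meson compact_attains_sup)
    then have \<tau>: "0 \<le> \<tau>" "\<tau> \<le> T" "\<gamma> \<tau> \<in> K" by (auto simp: V_def)
    have "f (\<gamma> \<tau>) \<le> f (\<gamma> T) + integral {\<tau>..T} (\<lambda>s. h (\<gamma> s))"
    proof (rule f_start_le_of_outside[OF lipschitz_on_subset[OF lipschitz] \<tau>(2)])
      show "\<gamma> t \<notin> K" if "\<tau> < t" "t \<le> T" for t
        using last[of t] that \<tau>(1) by (auto simp: V_def)
    qed (use \<tau> in auto)
    then have "curve_cost f h \<tau> \<gamma> \<le> curve_cost f h T \<gamma>"
      using curve_cost_split[OF \<gamma> \<tau>(1,2) h_continuous, of f] by (simp add: curve_cost_def)
    then show thesis using that(2) curve_from_stop[OF \<gamma>] \<tau> by blast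
  qed
qed

lemma f_bounded_below: obtains m where "\<And>x. x \<in> K \<Longrightarrow> m \<le> f x"
proof -
  have "compact (f ` K)"
    using compact_K continuous_on_subset[OF lipschitz_on_continuous_on[OF f_lipschitz]]
    by (intro compact_continuous_image) auto
  then have "bdd_below (f ` K)" by (intro bounded_imp_bdd_below compact_imp_bounded)
  then show thesis using that by (auto simp: bdd_below_def)
qed

lemma curve_cost_ge_duration:
  assumes "curve_from x T \<gamma>" "\<And>y. c \<le> h y"
  shows "f (\<gamma> T) + c * T \<le> curve_cost f h T \<gamma>"
proof -
  have "integral {0..T} (\<lambda>_. c) \<le> integral {0..T} (\<lambda>s. h (\<gamma> s))"
    using assms by (intro integral_le integrable_along_curve) (auto simp: curve_from_def)
  then show ?thesis using assms(1) by (simp add: curve_cost_def curve_from_def mult.commute)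
qed

lemma eikonal_envelope_le_curve_cost:
  assumes "curve_from x T \<gamma>"
  shows "eikonal_envelope f h x \<le> curve_cost f h T \<gamma>"
proof -
  obtain m where m: "\<And>y. y \<in> K \<Longrightarrow> m \<le> f y" using f_bounded_below by blast
  have "min m (f x) \<le> curve_cost f h S \<delta>" if "curve_from x S \<delta>" for S \<delta>
    using that
  proof (cases rule: curve_last_visit)
    case (visit \<tau>)
    then show ?thesis
      using m[of "\<delta> \<tau>"] curve_cost_ge_duration[of x \<tau> \<delta> 0] h_nonneg by simp
  qed simp
  then have "bdd_below {curve_cost f h T \<gamma> | T \<gamma>. curve_from x T \<gamma>}"
    by (auto intro!: bdd_belowI)
  then show ?thesis
    unfolding eikonal_envelope_def using assms by (intro cInf_lower) auto
qed

lemma eikonal_envelope_le: "eikonal_envelope f h x \<le> f x"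
  using eikonal_envelope_le_curve_cost[OF constant_curve_from, of x] by (simp add: curve_cost_def)

lemma eikonal_envelope_dynamic_programming:
  assumes \<alpha>: "curve_from x d \<alpha>"
  shows "eikonal_envelope f h x \<le> integral {0..d} (\<lambda>s. h (\<alpha> s)) + eikonal_envelope f h (\<alpha> d)"
proof -
  have "eikonal_envelope f h x - integral {0..d} (\<lambda>s. h (\<alpha> s)) \<le> eikonal_envelope f h (\<alpha> d)"
  proof (rule eikonal_envelope_greatest)
    fix T \<gamma> assume \<gamma>: "curve_from (\<alpha> d) T \<gamma>"
    have "eikonal_envelope f h x \<le> curve_cost f h (d + T) (join_curves d \<alpha> \<gamma>)"
      by (intro eikonal_envelope_le_curve_cost curve_from_join_curves \<alpha> \<gamma>)
    also have "\<dots> = integral {0..d} (\<lambda>s. h (\<alpha> s)) + curve_cost f h T \<gamma>"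
      by (rule curve_cost_join_curves[OF \<alpha> \<gamma> h_continuous])
    finally show "eikonal_envelope f h x - integral {0..d} (\<lambda>s. h (\<alpha> s)) \<le> curve_cost f h T \<gamma>"
      by simp
  qed
  then show ?thesis by simp
qed

lemma eikonal_envelope_segment:
  assumes c: "\<And>z. z \<in> closed_segment u v \<Longrightarrow> h z \<le> c"
  shows "eikonal_envelope f h u \<le> c * dist u v + eikonal_envelope f h v"
proof -
  define \<alpha> where "\<alpha> s = linepath u v (s / dist u v)" for s
  have \<alpha>: "curve_from u (dist u v) \<alpha>" unfolding \<alpha>_def by (rule segment_curve_from)
  have "\<alpha> s \<in> closed_segment u v" if "s \<in> {0..dist u v}" for s
    unfolding \<alpha>_def using that by (intro linepath_in_path) (auto simp: divide_le_eq_1)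
  then have "integral {0..dist u v} (\<lambda>s. h (\<alpha> s)) \<le> integral {0..dist u v} (\<lambda>_. c)"
    using \<alpha> c by (intro integral_le integrable_along_curve) (auto simp: curve_from_def)
  moreover have "\<alpha> (dist u v) = v" by (cases "u = v") (simp_all add: \<alpha>_def linepath_def)
  ultimately show ?thesis
    using eikonal_envelope_dynamic_programming[OF \<alpha>] by (simp add: mult.commute)
qed

lemma lipschitz_on_eikonal_envelope:
  assumes "convex S" "0 \<le> c" and c: "\<And>z. z \<in> S \<Longrightarrow> h z \<le> c"
  shows "c-lipschitz_on S (eikonal_envelope f h)"
proof (rule lipschitz_onI[OF _ \<open>0 \<le> c\<close>])
  fix u v assume "u \<in> S" "v \<in> S"
  then have "closed_segment u v \<subseteq> S" "closed_segment v u \<subseteq> S"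
    using \<open>convex S\<close> by (simp_all add: closed_segment_subset)
  then show "dist (eikonal_envelope f h u) (eikonal_envelope f h v) \<le> c * dist u v"
    using eikonal_envelope_segment[of u v c] eikonal_envelope_segment[of v u c] c
    by (auto simp: dist_real_def dist_commute subset_iff abs_le_iff)
qed

lemma Lip_a_eikonal_envelope_le: "Lip_a (eikonal_envelope f h) x \<le> ennreal (h x)"
proof (rule ennreal_le_epsilon)
  fix e :: real assume "e > 0"
  have "isCont h x" using h_continuous by (simp add: continuous_on_eq_continuous_at)
  then obtain r where "r > 0" and r: "\<And>z. dist z x < r \<Longrightarrow> dist (h z) (h x) < e"
    using \<open>e > 0\<close> unfolding continuous_at_eps_delta by blast
  have nonneg: "0 \<le> h x + e" using h_nonneg[of x] \<open>e > 0\<close> by simp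
  have "h z \<le> h x + e" if "z \<in> ball x r" for z
    using r[of z] that by (auto simp: dist_commute dist_real_def)
  then have "(h x + e)-lipschitz_on (ball x r) (eikonal_envelope f h)"
    by (intro lipschitz_on_eikonal_envelope convex_ball nonneg)
  then have "LIP (ball x r) (eikonal_envelope f h) \<le> ennreal (h x + e)"
    using nonneg by (simp add: lipschitz_on_iff_LIP_le)
  with Lip_a_le_LIP_ball[OF \<open>r > 0\<close>] have "Lip_a (eikonal_envelope f h) x \<le> ennreal (h x + e)"
    by (rule order_trans)
  then show "Lip_a (eikonal_envelope f h) x \<le> ennreal (h x) + ennreal e"
    using h_nonneg[of x] \<open>e > 0\<close> by simp
qed

lemma eikonal_envelope_less_imp_short_curve:
  assumes "eikonal_envelope f h x < e" "e \<le> f x"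
    and c: "0 < c" "\<And>y. c \<le> h y" and m: "\<And>y. y \<in> K \<Longrightarrow> m \<le> f y"
  obtains T \<gamma> where "curve_from x T \<gamma>" "T \<le> (e - m) / c" "curve_cost f h T \<gamma> < e"
proof -
  obtain S \<gamma> where \<gamma>: "curve_from x S \<gamma>" and cheap: "curve_cost f h S \<gamma> < e"
    using eikonal_envelope_lessD[OF assms(1)] .
  from \<gamma> show thesis
  proof (cases rule: curve_last_visit)
    case (visit \<tau>)
    have "m + c * \<tau> < e"
      using m[OF visit(2)] curve_cost_ge_duration[OF visit(1) c(2)] visit(3) cheap by linarith
    then have "\<tau> \<le> (e - m) / c" using c(1) by (simp add: field_simps)
    then show thesis using that visit cheap by auto
  qed (use cheap \<open>e \<le> f x\<close> in simp)
qed

end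

section \<open>Convergence of the envelopes\<close>

lemma increasing_eventually_bounded_away:
  fixes gs :: "nat \<Rightarrow> 'a::topological_space \<Rightarrow> real"
  assumes cont: "\<And>i. continuous_on UNIV (gs i)" and mono: "\<And>x. incseq (\<lambda>i. gs i x)"
    and lim: "\<And>x. (\<lambda>i. gs i x) \<longlonglongrightarrow> g x" and pos: "\<And>x. 0 < g x"
    and "compact K" and outside: "\<And>i x. x \<notin> K \<Longrightarrow> L \<le> gs i x" and "0 < L"
  shows "\<exists>c>0. \<forall>\<^sub>F i in sequentially. \<forall>x. c \<le> gs i x"
proof -
  define U where "U k = {x. 1 / real (Suc k) < gs k x}" for k
  have "open (U k)" for k
    unfolding U_def by (intro open_Collect_less cont continuous_intros)
  moreover have "K \<subseteq> (\<Union>k. U k)"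
  proof
    fix x
    have "(\<lambda>k. 1 / real (Suc k)) \<longlonglongrightarrow> 0"
      by (rule LIMSEQ_inverse_real_of_nat[unfolded inverse_eq_divide])
    then have "\<forall>\<^sub>F k in sequentially. 1 / real (Suc k) < g x / 2 \<and> g x / 2 < gs k x"
      using pos[of x] by (intro eventually_conj order_tendstoD[OF lim] order_tendstoD(2)) auto
    then obtain k where "1 / real (Suc k) < g x / 2" "g x / 2 < gs k x"
      using eventually_happens'[OF sequentially_bot] by blast
    then have "x \<in> U k" by (simp add: U_def)
    then show "x \<in> (\<Union>k. U k)" by blast
  qed
  ultimately obtain I where "finite I" and I: "K \<subseteq> (\<Union>k\<in>I. U k)"
    using compactE_image[OF \<open>compact K\<close>, of UNIV U] by metis
  define n where "n = Max (insert 0 I)"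
  have "min L (1 / real (Suc n)) \<le> gs i x" if "n \<le> i" for i x
  proof (cases "x \<in> K")
    case True
    then obtain k where "k \<in> I" and k: "1 / real (Suc k) < gs k x" using I by (auto simp: U_def)
    then have "k \<le> n" using \<open>finite I\<close> by (simp add: n_def)
    then have "1 / real (Suc n) \<le> 1 / real (Suc k)" "gs k x \<le> gs i x"
      using incseqD[OF mono, of k i] \<open>n \<le> i\<close> by (auto intro: divide_left_mono)
    with k show ?thesis by linarith
  qed (use outside[of x i] in auto)
  moreover have "0 < min L (1 / real (Suc n))" using \<open>0 < L\<close> by simp
  ultimately show ?thesis unfolding eventually_sequentially by blast
qed

locale upper_gradient_approximation =
  fixes f g :: "'a::{real_normed_vector,heine_borel} \<Rightarrow> real"
    and gs :: "nat \<Rightarrow> 'a \<Rightarrow> real" and L :: real and K :: "'a set"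
  assumes L_pos: "0 < L" and f_lipschitz: "L-lipschitz_on UNIV f" and compact_K: "compact K"
    and g_pos: "\<And>x. 0 < g x" and upper_gradient: "upper_gradient (\<lambda>x. ennreal (g x)) f"
    and gs_continuous: "\<And>i. continuous_on UNIV (gs i)" and gs_nonneg: "\<And>i x. 0 \<le> gs i x"
    and gs_le_Suc: "\<And>i x. gs i x \<le> gs (Suc i) x" and gs_tendsto: "\<And>x. (\<lambda>i. gs i x) \<longlonglongrightarrow> g x"
    and gs_outside: "\<And>i x. x \<notin> K \<Longrightarrow> L \<le> gs i x"

sublocale upper_gradient_approximation \<subseteq> eikonal f "gs i" L K for i
  by unfold_locales (fact f_lipschitz compact_K gs_continuous gs_nonneg gs_outside)+

context upper_gradient_approximation
begin

lemma incseq_gs: "incseq (\<lambda>i. gs i x)"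
  using gs_le_Suc by (rule incseq_SucI)

lemma curve_cost_gs_mono:
  assumes "curve_from x T \<gamma>" "i \<le> j"
  shows "curve_cost f (gs i) T \<gamma> \<le> curve_cost f (gs j) T \<gamma>"
  using assms incseqD[OF incseq_gs] unfolding curve_cost_def
  by (intro add_left_mono integral_le integrable_along_curve) (auto simp: curve_from_def)

lemma eikonal_envelope_gs_mono:
  assumes "i \<le> j"
  shows "eikonal_envelope f (gs i) x \<le> eikonal_envelope f (gs j) x"
proof (rule eikonal_envelope_greatest)
  fix T \<gamma> assume \<gamma>: "curve_from x T \<gamma>"
  then have "eikonal_envelope f (gs i) x \<le> curve_cost f (gs i) T \<gamma>"
    by (rule eikonal_envelope_le_curve_cost)
  also have "\<dots> \<le> curve_cost f (gs j) T \<gamma>" by (rule curve_cost_gs_mono[OF \<gamma> assms])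
  finally show "eikonal_envelope f (gs i) x \<le> curve_cost f (gs j) T \<gamma>" .
qed

lemma limit_of_cheap_curves:
  assumes cheap: "\<And>i. eikonal_envelope f (gs i) x < e" and "e \<le> f x"
  obtains C \<eta> where "C-lipschitz_on {0..1::real} \<eta>" "\<eta> 0 = x"
    "\<And>j. f (\<eta> 1) + C * integral {0..1} (\<lambda>s. gs j (\<eta> s)) \<le> e"
proof -
  obtain c n where "0 < c" and c: "\<And>i y. n \<le> i \<Longrightarrow> c \<le> gs i y"
    using increasing_eventually_bounded_away[OF gs_continuous incseq_gs gs_tendsto g_pos compact_K
        gs_outside L_pos]
    unfolding eventually_sequentially by blast
  obtain m where m: "\<And>y. y \<in> K \<Longrightarrow> m \<le> f y" using f_bounded_below by blast
  have "\<exists>T \<gamma>. curve_from x T \<gamma> \<and> T \<le> (e - m) / c \<and> curve_cost f (gs (i + n)) T \<gamma> < e" for i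
    by (rule eikonal_envelope_less_imp_short_curve[OF cheap[of "i + n"] \<open>e \<le> f x\<close> \<open>0 < c\<close> c m]) auto
  then obtain T \<gamma> where \<gamma>: "\<And>i. curve_from x (T i) (\<gamma> i)" and T: "\<And>i. T i \<le> (e - m) / c"
    and cost: "\<And>i. curve_cost f (gs (i + n)) (T i) (\<gamma> i) < e"
    by metis
  show thesis
  proof (rule curves_from_subsequence[OF \<gamma> T])
    fix r :: "nat \<Rightarrow> nat" and \<eta> :: "real \<Rightarrow> 'a" and C
    assume r: "strict_mono r" and \<eta>: "C-lipschitz_on {0..1} \<eta>" "\<eta> 0 = x"
      and lim: "\<And>f h. continuous_on UNIV f \<Longrightarrow> continuous_on UNIV h \<Longrightarrow>
        (\<lambda>i. curve_cost f h (T (r i)) (\<gamma> (r i))) \<longlonglongrightarrow> f (\<eta> 1) + C * integral {0..1} (\<lambda>s. h (\<eta> s))"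
    have "f (\<eta> 1) + C * integral {0..1} (\<lambda>s. gs j (\<eta> s)) \<le> e" for j
    proof (rule LIMSEQ_le_const2[OF lim[OF lipschitz_on_continuous_on[OF f_lipschitz]
        gs_continuous]])
      have "curve_cost f (gs j) (T (r i)) (\<gamma> (r i)) \<le> e" if "j \<le> i" for i
      proof -
        have "j \<le> r i + n" using that seq_suble[OF r, of i] by simp
        with \<gamma> have "curve_cost f (gs j) (T (r i)) (\<gamma> (r i))
          \<le> curve_cost f (gs (r i + n)) (T (r i)) (\<gamma> (r i))"
          by (rule curve_cost_gs_mono)
        with cost[of "r i"] show ?thesis by linarith
      qed
      then show "\<exists>N. \<forall>i\<ge>N. curve_cost f (gs j) (T (r i)) (\<gamma> (r i)) \<le> e" by blast
    qed
    with \<eta> show thesis by (rule that)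
  qed
qed

lemma eikonal_envelope_tendsto: "(\<lambda>i. eikonal_envelope f (gs i) x) \<longlonglongrightarrow> f x"
proof (rule increasing_tendsto)
  show "\<forall>\<^sub>F i in sequentially. eikonal_envelope f (gs i) x \<le> f x"
    by (simp add: eikonal_envelope_le)
  fix b assume "b < f x"
  then obtain e where e: "b < e" "e < f x" using dense by blast
  have "\<exists>i. b < eikonal_envelope f (gs i) x"
  proof (rule ccontr)
    assume "\<nexists>i. b < eikonal_envelope f (gs i) x"
    then have cheap: "eikonal_envelope f (gs i) x < e" for i
      using e(1) by (meson le_less_trans linorder_not_less)
    show False
    proof (rule limit_of_cheap_curves[OF cheap])
      fix C and \<eta> :: "real \<Rightarrow> 'a"
      assume "C-lipschitz_on {0..1} \<eta>" and start: "\<eta> 0 = x"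
        and cost: "\<And>j. f (\<eta> 1) + C * integral {0..1} (\<lambda>s. gs j (\<eta> s)) \<le> e"
      then interpret lipschitz_curve \<eta> 0 1 C by unfold_locales auto
      have "C * integral {0..1} (\<lambda>s. gs j (\<eta> s)) \<le> e - f (\<eta> 1)" for j using cost[of j] by simp
      then have "\<bar>f (\<eta> 0) - f (\<eta> 1)\<bar> \<le> e - f (\<eta> 1)"
        by (rule upper_gradient_bound[OF upper_gradient gs_continuous gs_nonneg
            gs_le_Suc gs_tendsto])
      then show False using start e(2) by simp
    qed (use e(2) in simp)
  qed
  then obtain i where "b < eikonal_envelope f (gs i) x" ..
  then show "\<forall>\<^sub>F i in sequentially. b < eikonal_envelope f (gs i) x"
    using less_le_trans[OF _ eikonal_envelope_gs_mono] unfolding eventually_sequentially by blast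
qed

end

theorem proposition3p15:
  fixes f g :: "real ^ 'n \<Rightarrow> real"
    and gs :: "nat \<Rightarrow> real ^ 'n \<Rightarrow> real"
    and R :: real
  assumes "\<exists>L. L-lipschitz_on UNIV f"
    and "LIP UNIV f > 0"
    and "\<And>x. 0 < g x"
    and "\<And>x. ennreal (g x) \<le> LIP UNIV f"
    and "lower_semicontinuous g"
    and "upper_gradient (\<lambda>x. ennreal (g x)) f"
    and "R > 0"
    and "\<And>x. x \<notin> ball 0 R \<Longrightarrow> ennreal (g x) = LIP UNIV f"
    and "\<And>i. continuous_on UNIV (gs i)"
    and "\<And>i x. 0 \<le> gs i x"
    and "\<And>i x. gs i x \<le> gs (Suc i) x"
    and "\<And>x. (\<lambda>i. gs i x) \<longlonglongrightarrow> g x"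
    and "\<And>i x. x \<notin> ball 0 R \<Longrightarrow> ennreal (gs i x) = LIP UNIV f"
  shows "\<exists>fs :: nat \<Rightarrow> real ^ 'n \<Rightarrow> real.
           (\<forall>i. LIP UNIV (fs i) \<le> LIP UNIV f) \<and>
           weak_star_converges fs f \<and>
           (\<forall>i x. Lip_a (fs i) x \<le> ennreal (gs i x))"
proof (intro exI conjI allI)
  obtain L where f: "L-lipschitz_on UNIV f" and LIP: "LIP UNIV f = ennreal L"
    using assms(1) LIP_attained by blast
  have L: "0 < L" using assms(2) by (simp add: LIP)
  have outside: "L \<le> gs i x" if "x \<notin> cball 0 R" for i x
    using assms(13)[of x i] that assms(10)[of i x] L by (simp add: LIP)
  interpret upper_gradient_approximation f g gs L "cball 0 R"
    by unfold_locales (fact L f compact_cball assms outside)+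
  have "gs i x \<le> L" for i x
    using incseq_le[OF incseq_gs gs_tendsto, of i x] assms(4)[of x] L by (simp add: LIP)
  then have lipschitz: "L-lipschitz_on UNIV (eikonal_envelope f (gs i))" for i
    using L by (intro lipschitz_on_eikonal_envelope) auto
  show "LIP UNIV (eikonal_envelope f (gs i)) \<le> LIP UNIV f" for i
    using lipschitz L by (simp add: LIP flip: lipschitz_on_iff_LIP_le)
  show "weak_star_converges (\<lambda>i. eikonal_envelope f (gs i)) f"
    using lipschitz f eikonal_envelope_tendsto by (rule weak_star_convergesI)
  show "Lip_a (eikonal_envelope f (gs i)) x \<le> ennreal (gs i x)" for i x
    by (rule Lip_a_eikonal_envelope_le)
qed

end
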